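(* Fix two functions $f_1,f_2:\mathbb{Z}^3\to\mathbb{R}_+$, where $\mathbb{R}_+=[0,\infty)$. There exists a solution $\hat u:\mathbb{Z}^3\times\mathbb{R}_+\to\mathbb{C}^3$, with real initial data $\hat u_0:\mathbb{Z}^3\to\mathbb{C}^3$ (that is, $\hat u_0(-\xi)=\overline{\hat u_0(\xi)}$ for all $\xi\in\mathbb{Z}^3$), of the Fourier-side Euler system $$\partial_t\hat u(\xi,t)=-2\pi i\sum_{\substack{\zeta,\eta\in\mathbb{Z}^3\\ \zeta+\eta=\xi}}\bigl(\hat u(\zeta,t)\cdot\eta\bigr)\,\hat u(\eta,t),\qquad \hat u(\xi,t)\cdot\xi=0,\qquad \hat u(\xi,0)=\hat u_0(\xi)\qquad(\xi\in\mathbb{Z}^3,\ t\ge 0),$$ such that: (i) the initial data satisfy $|\hat u_0(\xi)|\le f_1(\xi)$ for all $\xi\in\mathbb{Z}^3$ with $|\xi|>1$; (ii) for every $\xi\in\mathbb{Z}^3$ the function $\hat u(\xi,\cdot)$ is smooth in the time variable; (iii) there exist a time $T_0>0$ and a vector $\xi_1\in\mathbb{Z}^3\setminus\{0\}$ such that $|\hat u(m\xi_1,T_0)|=f_2(m\xi_1)$ for every $m\in\mathbb{Z}\setminus\{0\}$.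
   Context: The system arises by applying the Fourier transform, $\hat u_j(\xi,t)=\int_{\mathbb{T}^3}u_j(x,t)e^{-2\pi i\xi\cdot x}\,dx$ for $j=1,2,3$, to the incompressible Euler equations without external forcing on $\mathbb{T}^3=\mathbb{R}^3/\mathbb{Z}^3$, namely $\partial_t u=-(u\cdot\nabla)u-\nabla p$, $\operatorname{div}u=0$, $u(\cdot,0)=u_0$, where the initial data $u_0$ is a divergence-free vector field and the pressure $p(x,t)=p_0(t)$ is taken to be constant in the space variable, with $p_0\in C^\infty(\mathbb{R}_+)$. A solution is understood on the Fourier side, as a function $\hat u=(\hat u_1,\hat u_2,\hat u_3):\mathbb{Z}^3\times\mathbb{R}_+\to\mathbb{C}^3$ satisfying the displayed system for every $\xi\in\mathbb{Z}^3$ and $t\ge 0$. For $a\in\mathbb{C}^3$ and $b\in\mathbb{Z}^3$, $a\cdot b=\sum_{j=1}^3 a_jb_j$, and $|\cdot|$ denotes the Euclidean (Hermitian) norm. *)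

theory Defs
  imports "HOL-Analysis.Analysis"
begin

type_synonym freq = "int ^ 3"

definition freq_vec :: "freq \<Rightarrow> real ^ 3" where
  "freq_vec \<xi> = (\<chi> j. real_of_int (\<xi> $ j))"

text \<open>The pairing of a complex vector with a frequency is bilinear: no conjugation.\<close>

definition freq_dot :: "complex ^ 3 \<Rightarrow> freq \<Rightarrow> complex" where
  "freq_dot a b = (\<Sum>j\<in>UNIV. a $ j * of_int (b $ j))"

definition conj_vec :: "complex ^ 3 \<Rightarrow> complex ^ 3" where
  "conj_vec a = (\<chi> j. cnj (a $ j))"

text \<open>The Fourier coefficients of a real-valued vector field.\<close>

definition real_data :: "(freq \<Rightarrow> complex ^ 3) \<Rightarrow> bool" where
  "real_data v \<longleftrightarrow> (\<forall>\<xi>. v (- \<xi>) = conj_vec (v \<xi>))"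

text \<open>
  Derivatives of all orders exist relative to S. Here \<open>g k\<close> is the derivative of order k;
  at the end points of an interval the derivatives are one-sided.
\<close>

definition smooth_within :: "real set \<Rightarrow> (real \<Rightarrow> 'a :: real_normed_vector) \<Rightarrow> bool" where
  "smooth_within S f \<longleftrightarrow>
     (\<exists>g :: nat \<Rightarrow> real \<Rightarrow> 'a. (\<forall>t\<in>S. g 0 t = f t) \<and>
        (\<forall>k. \<forall>t\<in>S. (g k has_vector_derivative g (Suc k) t) (at t within S)))"

definition euler_term :: "(freq \<Rightarrow> real \<Rightarrow> complex ^ 3) \<Rightarrow> real \<Rightarrow> freq \<times> freq \<Rightarrow> complex ^ 3" where
  "euler_term u t = (\<lambda>(\<zeta>, \<eta>). freq_dot (u \<zeta> t) \<eta> *s u \<eta> t)"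

text \<open>
  The Euler system for the Fourier coefficients, with pressure constant in space. Only the
  values at times \<open>t \<ge> 0\<close> matter, and the time derivative at 0 is one-sided. The convolution
  sum is required to converge unconditionally (in \<open>complex ^ 3\<close>: absolutely), since \<open>infsum\<close>
  takes the value 0 on families that are not summable.
\<close>

definition fourier_euler_solution ::
    "(freq \<Rightarrow> real \<Rightarrow> complex ^ 3) \<Rightarrow> (freq \<Rightarrow> complex ^ 3) \<Rightarrow> bool" where
  "fourier_euler_solution u u0 \<longleftrightarrow>
     (\<forall>\<xi>. \<forall>t\<ge>0.
        euler_term u t summable_on {(\<zeta>, \<eta>). \<zeta> + \<eta> = \<xi>} \<and>
        (u \<xi> has_vector_derivative
           (- 2 * of_real pi * \<i>) *s (\<Sum>\<^sub>\<infinity>p\<in>{(\<zeta>, \<eta>). \<zeta> + \<eta> = \<xi>}. euler_term u t p))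
          (at t within {0..}) \<and>
        freq_dot (u \<xi> t) \<xi> = 0) \<and>
     (\<forall>\<xi>. u \<xi> 0 = u0 \<xi>)"

end

theory Submission
  imports Defs "HOL-Computational_Algebra.Polynomial"
begin

text \<open>
  On the Fourier side an evolution equation is an infinite system of ordinary differential
  equations, and such a system may have solutions that start from zero and do not stay zero,
  as in Tychonoff's example for the heat equation. The proof puts such a solution on top of a
  stationary shear flow.

  In physical space the velocity is \<open>(0, cos (2 \<pi> x\<^sub>1), h (x\<^sub>1, x\<^sub>2, t))\<close>. It is divergence free,
  and \<open>(u \<cdot> \<nabla>) u = (0, 0, cos (2 \<pi> x\<^sub>1) \<partial>\<^sub>2 h)\<close>, so the Euler equations with constant pressure
  reduce to the linear transport equation \<open>\<partial>\<^sub>t h = - cos (2 \<pi> x\<^sub>1) \<partial>\<^sub>2 h\<close>. For the Fourier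
  coefficients \<open>c (k, m)\<close> of \<open>h\<close> this is
  \<open>\<partial>\<^sub>t c (k, m) = - \<pi> i m (c (k - 1, m) + c (k + 1, m))\<close>.
  Different \<open>m\<close> do not interact, and for \<open>m \<noteq> 0\<close> the equation can be read as a recursion in \<open>k\<close>:
  the function \<open>c (0, m)\<close> is arbitrary, and if \<open>c\<close> is to be even in \<open>k\<close>, the other ones are
  determined as combinations of its time derivatives. If \<open>c (0, m)\<close> is a multiple of \<open>exp (- 1 / t)\<close>, all its derivatives vanish
  at time 0, so every \<open>c (k, m)\<close> starts from zero, and the initial velocity consists of the
  two modes \<open>(\<plusminus>1, 0, 0)\<close> only, for which no smallness is required. At time 1
  the value of \<open>c (0, m)\<close> is free for each \<open>m \<noteq> 0\<close>; this prescribes the moduli on the line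
  spanned by \<open>(0, 1, 0)\<close>. No convergence question arises for the convolution, because only two
  of its terms are nonzero, and so the size of the \<open>c (k, m)\<close> is irrelevant.
\<close>

section \<open>A smooth function that is flat at time zero\<close>

definition flat :: "real poly \<Rightarrow> real \<Rightarrow> real" where
  "flat p t = (if t \<le> 0 then 0 else poly p (1 / t) * exp (- (1 / t)))"

text \<open>By the chain rule, the derivative of \<open>p (1/t) exp (-1/t)\<close> is \<open>q (1/t) exp (-1/t)\<close> with
  \<open>q (x) = x\<^sup>2 (p (x) - p' (x))\<close>.\<close>

definition flat_deriv_poly :: "real poly \<Rightarrow> real poly" where
  "flat_deriv_poly p = [:0, 0, 1:] * (p - pderiv p)"

lemma tendsto_poly_mult_exp_minus:
  fixes p :: "real poly"
  shows "((\<lambda>x. poly p x * exp (- x)) \<longlongrightarrow> 0) at_top"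
proof -
  have "((\<lambda>x. \<Sum>i\<le>degree p. coeff p i * (x ^ i / exp x)) \<longlongrightarrow> (\<Sum>i\<le>degree p. coeff p i * 0)) at_top"
    by (intro tendsto_sum tendsto_mult tendsto_const tendsto_power_div_exp_0)
  then show ?thesis
    by (simp add: poly_altdef sum_distrib_right exp_minus divide_inverse mult.assoc)
qed

text \<open>At the origin the difference quotient is again of the form \<open>q (1/t) exp (-1/t)\<close>, with
  \<open>q (x) = x p (x)\<close>, and exponential decay beats every polynomial.\<close>

lemma flat_has_real_derivative:
  "(flat p has_real_derivative flat (flat_deriv_poly p) t) (at t)"
proof (cases t "0 :: real" rule: linorder_cases)
  case less
  have "((\<lambda>_. 0) has_real_derivative 0) (at t)" by simp
  then have "(flat p has_real_derivative 0) (at t)"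
    by (rule has_field_derivative_transform_within_open[where S = "{..<0}"])
       (use less in \<open>auto simp: flat_def\<close>)
  then show ?thesis using less by (simp add: flat_def)
next
  case greater
  have "((\<lambda>t. poly p (1 / t) * exp (- (1 / t))) has_real_derivative
      flat (flat_deriv_poly p) t) (at t)"
    using greater
    by (auto intro!: derivative_eq_intros DERIV_chain2[OF poly_DERIV]
        simp: flat_def flat_deriv_poly_def field_simps power2_eq_square)
  then show ?thesis
    by (rule has_field_derivative_transform_within_open[where S = "{0<..}"])
       (use greater in \<open>auto simp: flat_def\<close>)
next
  case equal
  have right: "((\<lambda>h. flat p h / h) \<longlongrightarrow> 0) (at_right 0)"
  proof -
    have "((\<lambda>h. poly (pCons 0 p) (inverse h) * exp (- inverse h)) \<longlongrightarrow> 0) (at_right 0)"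
      by (rule filterlim_compose[OF tendsto_poly_mult_exp_minus filterlim_inverse_at_top_right])
    moreover have "eventually (\<lambda>h. poly (pCons 0 p) (inverse h) * exp (- inverse h) = flat p h / h)
        (at_right 0)"
      by (rule eventually_at_right_less[THEN eventually_mono]) (auto simp: flat_def field_simps)
    ultimately show ?thesis
      by (rule Lim_transform_eventually)
  qed
  have left: "((\<lambda>h. flat p h / h) \<longlongrightarrow> 0) (at_left 0)"
    by (rule tendsto_eventually) (auto simp: flat_def eventually_at_filter)
  have "((\<lambda>h. flat p h / h) \<longlongrightarrow> 0) (at 0)"
    using left right by (rule filterlim_split_at)
  then show ?thesis
    using equal by (simp add: DERIV_def flat_def)
qed

definition flat_iter :: "nat \<Rightarrow> real \<Rightarrow> real" where
  "flat_iter n = flat ((flat_deriv_poly ^^ n) 1)"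

lemma flat_iter_has_real_derivative:
  "(flat_iter n has_real_derivative flat_iter (Suc n) t) (at t)"
  using flat_has_real_derivative[of "(flat_deriv_poly ^^ n) 1" t] by (simp add: flat_iter_def)

lemma flat_iter_at_0: "flat_iter n 0 = 0"
  by (simp add: flat_iter_def flat_def)

lemma flat_iter_0_at_1: "flat_iter 0 1 = exp (- 1)"
  by (simp add: flat_iter_def flat_def)

section \<open>A nonzero solution of the transport recursion with zero initial data\<close>

text \<open>
  The derivative of order \<open>n\<close> of \<open>T\<^sub>k (l d/dt) exp (-1/t)\<close>, where \<open>T\<^sub>k\<close> is the Chebyshev
  polynomial. For \<open>l = i / (2 \<pi> m)\<close> the recursion \<open>T\<^sub>k\<^sub>+\<^sub>2 = 2 x T\<^sub>k\<^sub>+\<^sub>1 - T\<^sub>k\<close> is the transport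
  equation solved for the coefficient with the largest index. The order of the derivative
  is an argument because the value at \<open>k + 2\<close> needs one more derivative of the value at \<open>k + 1\<close>.
\<close>

fun cheb :: "complex \<Rightarrow> nat \<Rightarrow> nat \<Rightarrow> real \<Rightarrow> complex" where
  "cheb l 0 n t = of_real (flat_iter n t)"
| "cheb l (Suc 0) n t = l * of_real (flat_iter (Suc n) t)"
| "cheb l (Suc (Suc k)) n t = 2 * l * cheb l (Suc k) (Suc n) t - cheb l k n t"

lemma cheb_has_vector_derivative:
  "(cheb l k n has_vector_derivative cheb l k (Suc n) t) (at t within S)"
proof -
  have base: "((\<lambda>t. complex_of_real (flat_iter n t)) has_vector_derivative
      complex_of_real (flat_iter (Suc n) t)) (at t within S)" for n
    by (rule has_vector_derivative_of_real[OF has_field_derivative_at_within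
          [OF flat_iter_has_real_derivative]])
  show ?thesis
  proof (induction k arbitrary: n rule: induct_nat_012)
    case 0
    have "cheb l 0 n = (\<lambda>t. complex_of_real (flat_iter n t))" for n
      by (simp add: fun_eq_iff)
    then show ?case
      by (simp only: base)
  next
    case 1
    have "cheb l (Suc 0) n = (\<lambda>t. l * complex_of_real (flat_iter (Suc n) t))" for n
      by (simp add: fun_eq_iff)
    then show ?case
      by (simp only: has_vector_derivative_mult_right base)
  next
    case (ge2 k)
    have "cheb l (Suc (Suc k)) n = (\<lambda>t. 2 * l * cheb l (Suc k) (Suc n) t - cheb l k n t)" for n
      by (simp add: fun_eq_iff)
    then show ?case
      by (simp only: has_vector_derivative_diff has_vector_derivative_mult_right ge2)
  qed
qed

lemma cheb_at_0: "cheb l k n 0 = 0"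
  by (induction l k n "0::real" rule: cheb.induct) (simp_all add: flat_iter_at_0)

text \<open>The even extension in \<open>k\<close> satisfies the recursion at every integer. At \<open>k = 0\<close> the two
  neighbours coincide, which agrees with \<open>T\<^sub>1 = x\<close>.\<close>

lemma cheb_recursion:
  "2 * l * cheb l (nat \<bar>k\<bar>) (Suc n) t = cheb l (nat \<bar>k - 1\<bar>) n t + cheb l (nat \<bar>k + 1\<bar>) n t"
proof -
  have pos: "2 * l * cheb l (Suc j) (Suc n) t = cheb l j n t + cheb l (Suc (Suc j)) n t" for j
    by simp
  consider "k = 0" | j where "k = int (Suc j)" | j where "k = - int (Suc j)"
  proof (cases k rule: int_cases3)
    case (pos i)
    then show thesis using that(2)[of "i - 1"] by simp
  next
    case (neg i)
    then show thesis using that(3)[of "i - 1"] by simp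
  qed (rule that(1))
  then show ?thesis
  proof cases
    case 1
    then show ?thesis by simp
  next
    case (2 j)
    then have "nat \<bar>k\<bar> = Suc j" "nat \<bar>k - 1\<bar> = j" "nat \<bar>k + 1\<bar> = Suc (Suc j)" by auto
    then show ?thesis by (simp only: pos)
  next
    case (3 j)
    then have "nat \<bar>k\<bar> = Suc j" "nat \<bar>k + 1\<bar> = j" "nat \<bar>k - 1\<bar> = Suc (Suc j)" by auto
    then show ?thesis by (simp only: pos add.commute)
  qed
qed

section \<open>Passive transport by a stationary shear flow\<close>

text \<open>The coefficient \<open>1/2\<close> at \<open>(\<plusminus>1, 0, 0)\<close> is that of \<open>cos (2 \<pi> x\<^sub>1)\<close>.\<close>

definition shear_profile :: "freq \<Rightarrow> complex" where
  "shear_profile \<xi> = (if \<xi> = axis 1 1 \<or> \<xi> = - axis 1 1 then 1 / 2 else 0)"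

definition shear_flow :: "(freq \<Rightarrow> complex) \<Rightarrow> freq \<Rightarrow> complex ^ 3" where
  "shear_flow c \<xi> = vector [0, shear_profile \<xi>, c \<xi>]"

lemma shear_profile_eq_0: "\<xi> $ 2 \<noteq> 0 \<or> \<xi> $ 3 \<noteq> 0 \<Longrightarrow> shear_profile \<xi> = 0"
  by (auto simp: shear_profile_def axis_def)

lemma freq_dot_shear_flow: "freq_dot (shear_flow c \<zeta>) \<eta> = shear_profile \<zeta> * \<eta> $ 2 + c \<zeta> * \<eta> $ 3"
  by (simp add: freq_dot_def shear_flow_def sum_3)

text \<open>Since nothing depends on \<open>x\<^sub>3\<close>, the third component does not advect anything, and the
  shear profile does not advect itself because it depends on \<open>x\<^sub>1\<close> only. What remains is the
  shear profile advecting the third component.\<close>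

lemma euler_term_shear_flow:
  fixes c :: "freq \<Rightarrow> real \<Rightarrow> complex"
  assumes "\<And>\<xi>. \<xi> $ 3 \<noteq> 0 \<Longrightarrow> c \<xi> t = 0"
  shows "euler_term (\<lambda>\<xi> t. shear_flow (\<lambda>\<xi>. c \<xi> t) \<xi>) t (\<zeta>, \<eta>) =
    vector [0, 0, shear_profile \<zeta> * \<eta> $ 2 * c \<eta> t]"
proof -
  have "euler_term (\<lambda>\<xi> t. shear_flow (\<lambda>\<xi>. c \<xi> t) \<xi>) t (\<zeta>, \<eta>) =
      (shear_profile \<zeta> * \<eta> $ 2 + c \<zeta> t * \<eta> $ 3) *s shear_flow (\<lambda>\<xi>. c \<xi> t) \<eta>"
    by (simp add: euler_term_def freq_dot_shear_flow)
  then show ?thesis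
    using assms[of \<eta>] shear_profile_eq_0[of \<eta>]
    by (cases "\<eta> $ 2 = 0"; cases "\<eta> $ 3 = 0") (simp_all add: shear_flow_def vec_eq_iff forall_3)
qed

text \<open>By the previous lemma a nonzero term of the convolution has \<open>\<zeta> = (\<plusminus>1, 0, 0)\<close>, so the sum
  is finite whatever the growth of \<open>c\<close>.\<close>

lemma has_sum_euler_term_shear_flow:
  fixes c :: "freq \<Rightarrow> real \<Rightarrow> complex"
  assumes "\<And>\<xi>. \<xi> $ 3 \<noteq> 0 \<Longrightarrow> c \<xi> t = 0"
  shows "(euler_term (\<lambda>\<xi> t. shear_flow (\<lambda>\<xi>. c \<xi> t) \<xi>) t has_sum
      vector [0, 0, \<xi> $ 2 / 2 * (c (\<xi> - axis 1 1) t + c (\<xi> + axis 1 1) t)])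
    {(\<zeta>, \<eta>). \<zeta> + \<eta> = \<xi>}" (is "(?f has_sum ?s) ?A")
proof -
  let ?e = "axis 1 1 :: freq"
  let ?B = "{(?e, \<xi> - ?e), (- ?e, \<xi> + ?e)}"
  have terms: "?f (\<zeta>, \<eta>) = vector [0, 0, shear_profile \<zeta> * \<eta> $ 2 * c \<eta> t]" for \<zeta> \<eta>
    by (rule euler_term_shear_flow) (rule assms)
  have "?e $ 1 \<noteq> (- ?e) $ 1" by simp
  then have ne: "?e \<noteq> - ?e" by metis
  have "sum ?f ?B = ?s"
    using ne by (auto simp: terms shear_profile_def vec_eq_iff forall_3 axis_def field_simps)
  then have "(?f has_sum ?s) ?B"
    using has_sum_finite[of ?B ?f] by simp
  moreover have "(?f has_sum ?s) ?B \<longleftrightarrow> (?f has_sum ?s) ?A"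
  proof (rule has_sum_cong_neutral)
    show "?f p = 0" if "p \<in> ?A - ?B" for p
    proof (cases p)
      case (Pair \<zeta> \<eta>)
      then have "\<zeta> \<noteq> ?e" "\<zeta> \<noteq> - ?e" using that by auto
      then have "shear_profile \<zeta> = 0" by (simp add: shear_profile_def)
      then show ?thesis by (simp add: Pair terms vec_eq_iff forall_3)
    qed
    show "?f p = 0" if "p \<in> ?B - ?A" for p
      using that by auto
  qed auto
  ultimately show ?thesis by simp
qed

lemma vector_3_has_vector_derivative:
  fixes a b c :: "real \<Rightarrow> complex"
  assumes "(a has_vector_derivative a') F" "(b has_vector_derivative b') F"
    "(c has_vector_derivative c') F"
  shows "((\<lambda>t. vector [a t, b t, c t] :: complex ^ 3) has_vector_derivative vector [a', b', c']) F"
proof -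
  have eq: "(vector [x, y, z] :: complex ^ 3) = axis 1 x + axis 2 y + axis 3 z" for x y z
    by (simp add: vec_eq_iff forall_3 axis_def)
  have axis: "bounded_linear (axis i :: complex \<Rightarrow> complex ^ 3)" for i
    by (simp add: linear_iff axis_def vec_eq_iff flip: linear_conv_bounded_linear)
  show ?thesis
    unfolding eq
    by (intro has_vector_derivative_add bounded_linear.has_vector_derivative[OF axis] assms)
qed

text \<open>The third component of the system is the transport equation; the second one says that the
  profile is stationary, and the first one is void. The divergence vanishes because the second
  component does not depend on \<open>x\<^sub>2\<close>, nor the third one on \<open>x\<^sub>3\<close>.\<close>

lemma fourier_euler_solution_shear_flow:
  fixes c :: "freq \<Rightarrow> real \<Rightarrow> complex"
  assumes supp: "\<And>\<xi> t. \<xi> $ 3 \<noteq> 0 \<Longrightarrow> c \<xi> t = 0"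
    and transport: "\<And>\<xi> t. t \<ge> 0 \<Longrightarrow> (c \<xi> has_vector_derivative
      - \<i> * pi * \<xi> $ 2 * (c (\<xi> - axis 1 1) t + c (\<xi> + axis 1 1) t)) (at t within {0..})"
  shows "fourier_euler_solution (\<lambda>\<xi> t. shear_flow (\<lambda>\<xi>. c \<xi> t) \<xi>) (shear_flow (\<lambda>\<xi>. c \<xi> 0))"
  unfolding fourier_euler_solution_def
proof (intro conjI allI impI)
  fix \<xi> :: freq and t :: real
  assume t: "t \<ge> 0"
  let ?u = "\<lambda>\<xi> t. shear_flow (\<lambda>\<xi>. c \<xi> t) \<xi>"
  note sum = has_sum_euler_term_shear_flow[of c t \<xi>, OF supp]
  show "euler_term ?u t summable_on {(\<zeta>, \<eta>). \<zeta> + \<eta> = \<xi>}"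
    using sum by (blast intro: has_sum_imp_summable)
  have "(?u \<xi> has_vector_derivative
      vector [0, 0, - \<i> * pi * \<xi> $ 2 * (c (\<xi> - axis 1 1) t + c (\<xi> + axis 1 1) t)]) (at t within {0..})"
    unfolding shear_flow_def
    by (intro vector_3_has_vector_derivative has_vector_derivative_const transport t)
  moreover have "vector [0, 0, - \<i> * pi * \<xi> $ 2 * (c (\<xi> - axis 1 1) t + c (\<xi> + axis 1 1) t)] =
      (- 2 * of_real pi * \<i>) *s (\<Sum>\<^sub>\<infinity>p\<in>{(\<zeta>, \<eta>). \<zeta> + \<eta> = \<xi>}. euler_term ?u t p)"
    by (subst infsumI[OF sum]) (simp_all add: vec_eq_iff forall_3)
  ultimately show "(?u \<xi> has_vector_derivative
      (- 2 * of_real pi * \<i>) *s (\<Sum>\<^sub>\<infinity>p\<in>{(\<zeta>, \<eta>). \<zeta> + \<eta> = \<xi>}. euler_term ?u t p))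
      (at t within {0..})"
    by simp
  show "freq_dot (?u \<xi> t) \<xi> = 0"
    using supp[of \<xi> t] shear_profile_eq_0[of \<xi>]
    by (cases "\<xi> $ 2 = 0"; cases "\<xi> $ 3 = 0") (simp_all add: freq_dot_shear_flow)
qed simp

lemma smooth_within_shear_flow:
  fixes c :: "freq \<Rightarrow> real \<Rightarrow> complex"
  assumes deriv: "\<And>k t. t \<in> S \<Longrightarrow> (g k has_vector_derivative g (Suc k) t) (at t within S)"
    and g0: "\<And>t. t \<in> S \<Longrightarrow> g 0 t = c \<xi> t"
  shows "smooth_within S (\<lambda>t. shear_flow (\<lambda>\<xi>. c \<xi> t) \<xi>)"
proof -
  let ?G = "\<lambda>k t. vector [0, if k = 0 then shear_profile \<xi> else 0, g k t] :: complex ^ 3"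
  have "?G 0 t = shear_flow (\<lambda>\<xi>. c \<xi> t) \<xi>" if "t \<in> S" for t
    using g0[OF that] by (simp add: shear_flow_def)
  moreover have "(?G k has_vector_derivative ?G (Suc k) t) (at t within S)" if "t \<in> S" for k t
    by (intro vector_3_has_vector_derivative) (use deriv[OF that] in \<open>auto intro: has_vector_derivative_const\<close>)
  ultimately show ?thesis
    unfolding smooth_within_def by (intro exI[of _ ?G]) blast
qed

section \<open>Growth out of two modes\<close>

theorem theorem1p1:
  fixes f1 f2 :: "int ^ 3 \<Rightarrow> real"
  assumes "\<And>\<xi>. 0 \<le> f1 \<xi>" and "\<And>\<xi>. 0 \<le> f2 \<xi>"
  shows "\<exists>(u :: int ^ 3 \<Rightarrow> real \<Rightarrow> complex ^ 3) (u0 :: int ^ 3 \<Rightarrow> complex ^ 3).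
    fourier_euler_solution u u0 \<and>
    real_data u0 \<and>
    (\<forall>\<xi>. norm (freq_vec \<xi>) > 1 \<longrightarrow> norm (u0 \<xi>) \<le> f1 \<xi>) \<and>
    (\<forall>\<xi>. smooth_within {0..} (u \<xi>)) \<and>
    (\<exists>T0 > 0. \<exists>\<xi>1. \<xi>1 \<noteq> 0 \<and>
       (\<forall>m :: int. m \<noteq> 0 \<longrightarrow> norm (u (m *s \<xi>1) T0) = f2 (m *s \<xi>1)))"
proof -
  let ?e1 = "axis 1 1 :: freq" and ?e2 = "axis 2 1 :: freq"
  \<comment> \<open>The factor \<open>exp 1\<close> compensates the value \<open>exp (- 1)\<close> of the flat function at time 1.\<close>
  define a :: "freq \<Rightarrow> complex" where
    "a \<xi> = (if \<xi> $ 2 \<noteq> 0 \<and> \<xi> $ 3 = 0 then of_real (f2 (\<xi> $ 2 *s ?e2) * exp 1) else 0)" for \<xi>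
  define l :: "freq \<Rightarrow> complex" where "l \<xi> = \<i> / (2 * pi * \<xi> $ 2)" for \<xi>
  define d where "d n \<xi> t = a \<xi> * cheb (l \<xi>) (nat \<bar>\<xi> $ 1\<bar>) n t" for n \<xi> t
  define u where "u \<xi> t = shear_flow (\<lambda>\<xi>. d 0 \<xi> t) \<xi>" for \<xi> t
  define u0 where "u0 = shear_flow (\<lambda>\<xi>. d 0 \<xi> 0)"
  have d_deriv: "(d n \<xi> has_vector_derivative d (Suc n) \<xi> t) (at t within {0..})" for n \<xi> t
    unfolding d_def[abs_def]
    by (intro has_vector_derivative_mult_right cheb_has_vector_derivative)
  have transport: "d 1 \<xi> t = - \<i> * pi * \<xi> $ 2 * (d 0 (\<xi> - ?e1) t + d 0 (\<xi> + ?e1) t)" for \<xi> t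
  proof (cases "\<xi> $ 2 = 0")
    case True
    then show ?thesis by (simp add: d_def a_def)
  next
    case False
    have nb: "(\<xi> - ?e1) $ 1 = \<xi> $ 1 - 1" "(\<xi> + ?e1) $ 1 = \<xi> $ 1 + 1"
      "a (\<xi> - ?e1) = a \<xi>" "a (\<xi> + ?e1) = a \<xi>" "l (\<xi> - ?e1) = l \<xi>" "l (\<xi> + ?e1) = l \<xi>"
      by (simp_all add: a_def l_def axis_def)
    have inv: "- \<i> * pi * \<xi> $ 2 * (2 * l \<xi>) = 1"
      using False by (simp add: l_def field_simps)
    have "- \<i> * pi * \<xi> $ 2 * (d 0 (\<xi> - ?e1) t + d 0 (\<xi> + ?e1) t)
        = - \<i> * pi * \<xi> $ 2 * a \<xi> * (2 * l \<xi> * cheb (l \<xi>) (nat \<bar>\<xi> $ 1\<bar>) (Suc 0) t)"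
      unfolding cheb_recursion d_def nb by (simp add: algebra_simps)
    also have "\<dots> = (- \<i> * pi * \<xi> $ 2 * (2 * l \<xi>)) * d 1 \<xi> t"
      by (simp add: d_def mult_ac)
    finally show ?thesis unfolding inv by simp
  qed
  have u0_eq: "u0 \<xi> = vector [0, shear_profile \<xi>, 0]" for \<xi>
    by (simp add: u0_def shear_flow_def d_def cheb_at_0)
  have "fourier_euler_solution u u0"
    unfolding u_def[abs_def] u0_def
  proof (rule fourier_euler_solution_shear_flow)
    show "d 0 \<xi> t = 0" if "\<xi> $ 3 \<noteq> 0" for \<xi> t
      using that by (simp add: d_def a_def)
    show "(d 0 \<xi> has_vector_derivative
        - \<i> * pi * \<xi> $ 2 * (d 0 (\<xi> - ?e1) t + d 0 (\<xi> + ?e1) t)) (at t within {0..})" for \<xi> t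
      using d_deriv[of 0 \<xi> t] transport[of \<xi> t] by simp
  qed
  moreover have "real_data u0"
  proof -
    have "shear_profile (- \<xi>) = cnj (shear_profile \<xi>)" for \<xi>
    proof -
      have "- \<xi> = ?e1 \<longleftrightarrow> \<xi> = - ?e1" by (metis minus_minus)
      then show ?thesis by (auto simp: shear_profile_def)
    qed
    then show ?thesis
      by (simp add: real_data_def u0_eq conj_vec_def vec_eq_iff forall_3)
  qed
  moreover have "norm (u0 \<xi>) \<le> f1 \<xi>" if "norm (freq_vec \<xi>) > 1" for \<xi>
  proof -
    have "norm (freq_vec ?e1) = 1" "norm (freq_vec (- ?e1)) = 1"
      by (simp_all add: freq_vec_def norm_vec_def L2_set_def sum_3 axis_def)
    then have "shear_profile \<xi> = 0"
      using that by (auto simp: shear_profile_def)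
    then have "u0 \<xi> = 0" by (simp add: u0_eq vec_eq_iff forall_3)
    then show ?thesis using assms(1) by simp
  qed
  moreover have "smooth_within {0..} (u \<xi>)" for \<xi>
    unfolding u_def[abs_def]
    by (rule smooth_within_shear_flow[where g = "\<lambda>n. d n \<xi>"]) (auto intro: d_deriv)
  moreover have "norm (u (m *s ?e2) 1) = f2 (m *s ?e2)" if "m \<noteq> 0" for m
  proof -
    have coord: "(m *s ?e2) $ 1 = 0" "(m *s ?e2) $ 2 = m" "(m *s ?e2) $ 3 = 0"
      by (simp_all add: axis_def)
    have "d 0 (m *s ?e2) 1 = of_real (f2 (m *s ?e2) * (exp 1 * exp (- 1)))"
      using that by (simp add: d_def a_def coord flat_iter_0_at_1 del: vector_smult_component)
    also have "exp 1 * exp (- 1 :: real) = 1"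
      by (simp flip: exp_add)
    finally have "u (m *s ?e2) 1 = vector [0, 0, of_real (f2 (m *s ?e2))]"
      using that coord shear_profile_eq_0[of "m *s ?e2"] by (simp add: u_def shear_flow_def)
    then show ?thesis
      using assms(2) by (simp add: norm_vec_def L2_set_def sum_3)
  qed
  moreover have "?e2 \<noteq> 0" by simp
  ultimately show ?thesis
    by (intro exI[of _ u] exI[of _ u0] conjI allI impI exI[of _ "1 :: real"] exI[of _ ?e2]) auto
qed

end
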